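(* Let $T:X\rightrightarrows X^*$ be maximal monotone and let $\{x^k\}_{k=0}^\infty\subseteq X$, $\{v^k\}_{k=0}^\infty\subseteq X^*$ satisfy, for all $k\ge0$, $v^k\in T(x^{k+1})$ and $x^{k+1}=x^k-\nabla\phi^*(v^k)$. Set $y^k:=x^k-x^{k+1}$, so that $v^k=\nabla\phi(y^k)$. Then the following hold: (i) $D_{\phi^*}(v^{k+1}, 0) \leq D_{\phi^*}(v^{k}, 0) -D_{\phi^*}(v^k, v^{k+1})$ for all $k\geq 0$. (ii) $\{D_{\phi^*}(v^k, 0)\}_{k=0}^\infty$ converges. (iii) $\{D_{\phi^*}(v^k, v^{k+1})\}_{k=0}^\infty$ is summable, and in particular $\lim_{k \to \infty} D_{\phi^*}(v^{k}, v^{k+1}) = 0$. (iv) $D_{\phi^*}(v^k, 0)=D_{\phi}(0, y^k)$ and $D_{\phi^*}(v^k, v^{k+1})=D_{\phi}(y^{k+1}, y^k)$ for all $k\ge0$. (v) $0 \leq \sum_{k=0}^\infty \langle x^{k+2} -x^{k+1},v^{k+1} - v^k \rangle < \infty$, and hence $\lim_{k \to \infty}\langle x^{k+2} - x^{k+1},v^{k+1} -v^k \rangle = 0$. (vi) $\{v^k\}_{k=0}^\infty$ and $\{y^k\}_{k=0}^\infty$ are bounded.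
   Context: $X$ is a (finite-dimensional) Euclidean space, $X^*=X$ its dual, with pairing $\langle\cdot,\cdot\rangle$ the Euclidean inner product. The prox-function $\phi: X \to \mathbb{R}$ is strictly convex, smooth (differentiable on all of $X$) and super-coercive ($\phi(x)/\|x\| \to \infty$ as $\|x\|\to\infty$), with $\nabla\phi(0)=0$; its convex conjugate $\phi^*:X^*\to\mathbb{R}$ has the same properties, $\nabla\phi:X\to X^*$ is a bijection with inverse $\nabla\phi^*$, and $\nabla\phi^*(0)=0$. Bregman distances: $D_{\phi^*}(u,v)=\phi^*(u)-\phi^*(v)-\langle\nabla\phi^*(v),u-v\rangle$ for $u,v\in X^*$, and analogously $D_\phi(x,y)=\phi(x)-\phi(y)-\langle\nabla\phi(y),x-y\rangle$ for $x,y\in X$. $T$ is monotone if $\langle x-y,x^*-y^*\rangle\ge 0$ for all $(x,x^* ),(y,y^* )$ in its graph, and maximal monotone if its graph is not strictly contained in the graph of another monotone mapping. *)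

theory Defs
  imports "HOL-Analysis.Analysis"
begin

definition strictly_convex_on :: "'a::real_vector set \<Rightarrow> ('a \<Rightarrow> real) \<Rightarrow> bool"
  where "strictly_convex_on S f \<longleftrightarrow> convex S \<and>
    (\<forall>x\<in>S. \<forall>y\<in>S. \<forall>u>0. \<forall>v>0. x \<noteq> y \<longrightarrow> u + v = 1 \<longrightarrow>
      f (u *\<^sub>R x + v *\<^sub>R y) < u * f x + v * f y)"

definition super_coercive :: "('a::real_normed_vector \<Rightarrow> real) \<Rightarrow> bool"
  where "super_coercive f \<longleftrightarrow> filterlim (\<lambda>x. f x / norm x) at_top at_infinity"

(* Meaningful only at points of differentiability, where the vector D is unique. *)
definition gradient :: "('a::euclidean_space \<Rightarrow> real) \<Rightarrow> 'a \<Rightarrow> 'a"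
  where "gradient f x = (THE D. GDERIV f x :> D)"

(* The supremum is taken in the reals, so this is the usual conjugate only where the set is
   bounded above. For a continuous super-coercive f on a Euclidean space it always is. *)
definition convex_conjugate :: "('a::euclidean_space \<Rightarrow> real) \<Rightarrow> 'a \<Rightarrow> real"
  where "convex_conjugate f u = (SUP x. inner u x - f x)"

definition bregman :: "('a::euclidean_space \<Rightarrow> real) \<Rightarrow> 'a \<Rightarrow> 'a \<Rightarrow> real"
  where "bregman f u v = f u - f v - inner (gradient f v) (u - v)"

(* A set-valued mapping X \<rightrightarrows> X* is a function into sets, with X* identified with X. *)
definition mapping_graph :: "('a \<Rightarrow> 'b set) \<Rightarrow> ('a \<times> 'b) set"
  where "mapping_graph T = {(x, u). u \<in> T x}"

definition monotone_mapping :: "('a::real_inner \<Rightarrow> 'a set) \<Rightarrow> bool"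
  where "monotone_mapping T \<longleftrightarrow>
    (\<forall>(x, u) \<in> mapping_graph T. \<forall>(y, w) \<in> mapping_graph T. inner (x - y) (u - w) \<ge> 0)"

definition maximal_monotone_mapping :: "('a::real_inner \<Rightarrow> 'a set) \<Rightarrow> bool"
  where "maximal_monotone_mapping T \<longleftrightarrow> monotone_mapping T \<and>
    \<not> (\<exists>S. monotone_mapping S \<and> mapping_graph T \<subset> mapping_graph S)"

end

theory Submission
  imports Defs
begin

text \<open>
  The maximizer of \<open>\<langle>u, \<cdot>\<rangle> - \<phi>\<close> exists by super-coercivity, is unique by strict convexity, and
  depends continuously on \<open>u\<close> because its graph is closed and locally bounded. Hence it is the
  gradient of \<open>\<phi>*\<close>, and it inverts the gradient of \<open>\<phi>\<close>. Since \<open>\<nabla>\<phi>*(0) = 0\<close>, the three-point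
  identity reads
  \<open>D(v\<^sub>k, 0) - D(v\<^sub>k\<^sub>+\<^sub>1, 0) - D(v\<^sub>k, v\<^sub>k\<^sub>+\<^sub>1) = \<langle>\<nabla>\<phi>*(v\<^sub>k\<^sub>+\<^sub>1), v\<^sub>k - v\<^sub>k\<^sub>+\<^sub>1\<rangle>\<close>,
  whose right-hand side is nonnegative by monotonicity of \<open>T\<close>. Everything else telescopes, and
  coercivity of \<open>\<phi>*\<close> turns the bound on \<open>D(v\<^sub>k, 0)\<close> into a bound on \<open>v\<^sub>k\<close>.
\<close>

section \<open>Gradients as vectors representing the derivative\<close>

lemma gradient_eqI:
  assumes "GDERIV f x :> D"
  shows "gradient f x = D"
  unfolding gradient_def
proof (rule the_equality)
  show "GDERIV f x :> D"
    by (rule assms)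
  fix E assume "GDERIV f x :> E"
  then have "(\<lambda>h. inner h E) = (\<lambda>h. inner h D)"
    using assms unfolding gderiv_def by (rule has_derivative_unique)
  then show "E = D"
    by (metis vector_eq_ldot)
qed

text \<open>In finite dimension the derivative is the inner product with the vector assembled from
  its values on the basis, so the description in \<open>gradient\<close> denotes.\<close>

lemma GDERIV_gradient:
  fixes f :: "'a::euclidean_space \<Rightarrow> real"
  assumes "f differentiable (at x)"
  shows "GDERIV f x :> gradient f x"
proof -
  obtain f' where f': "(f has_derivative f') (at x)"
    using assms unfolding differentiable_def by blast
  then interpret f': bounded_linear f'
    by (rule has_derivative_bounded_linear)
  define D where "D = (\<Sum>b\<in>Basis. f' b *\<^sub>R b)"
  have "f' h = inner h D" for h
  proof -
    have "f' h = f' (\<Sum>b\<in>Basis. inner h b *\<^sub>R b)"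
      by (simp add: euclidean_representation)
    also have "\<dots> = inner h D"
      by (simp add: f'.sum f'.scaleR D_def inner_sum_right mult.commute)
    finally show ?thesis .
  qed
  then have "GDERIV f x :> D"
    using f' unfolding gderiv_def by (metis (no_types, lifting) ext)
  then show ?thesis
    using gradient_eqI by metis
qed

section \<open>Convexity and super-coercivity\<close>

lemma strictly_convex_on_imp_convex_on:
  assumes "strictly_convex_on S f"
  shows "convex_on S f"
  unfolding convex_on_def
proof (intro conjI ballI allI impI)
  show "convex S"
    using assms unfolding strictly_convex_on_def by blast
  fix x y :: 'a and u v :: real
  assume *: "x \<in> S" "y \<in> S" "0 \<le> u" "0 \<le> v" "u + v = 1"
  consider "u = 0" "v = 1" | "u = 1" "v = 0" | "x = y" | "u > 0" "v > 0" "x \<noteq> y"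
    using * by fastforce
  then show "f (u *\<^sub>R x + v *\<^sub>R y) \<le> u * f x + v * f y"
  proof cases
    case 3
    then show ?thesis
      using * by (metis order_refl scaleR_left_distrib scaleR_one distrib_right mult_1)
  next
    case 4
    then show ?thesis
      using * assms unfolding strictly_convex_on_def by (meson less_imp_le)
  qed simp_all
qed

text \<open>Along the line from \<open>x\<close> to \<open>z\<close> the function is convex with
  slope 0 at \<open>x\<close>, so it lies above its horizontal tangent.\<close>

lemma convex_on_stationary_imp_minimizer:
  fixes f :: "'a::euclidean_space \<Rightarrow> real"
  assumes "convex_on UNIV f" and "GDERIV f x :> 0"
  shows "f x \<le> f z"
proof -
  define g where "g t = f (x + t *\<^sub>R (z - x))" for t :: real
  have "convex_on UNIV g"
    unfolding convex_on_def
  proof (intro conjI ballI allI impI)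
    fix s t u v :: real
    assume uv: "0 \<le> u" "0 \<le> v" "u + v = 1"
    have "x + (u * s + v * t) *\<^sub>R (z - x) = (u + v) *\<^sub>R x + (u * s + v * t) *\<^sub>R (z - x)"
      using uv by simp
    also have "\<dots> = u *\<^sub>R (x + s *\<^sub>R (z - x)) + v *\<^sub>R (x + t *\<^sub>R (z - x))"
      by (simp add: algebra_simps)
    finally show "g (u *\<^sub>R s + v *\<^sub>R t) \<le> u * g s + v * g t"
      using assms(1) uv unfolding g_def convex_on_def by simp
  qed simp
  moreover have "(g has_real_derivative 0) (at 0)"
  proof -
    have "((\<lambda>t::real. x + t *\<^sub>R (z - x)) has_derivative (\<lambda>t. t *\<^sub>R (z - x))) (at 0)"
      by (auto intro!: derivative_eq_intros)
    moreover have "(f has_derivative (\<lambda>h. 0)) (at (x + 0 *\<^sub>R (z - x)))"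
      using assms(2) unfolding gderiv_def by simp
    ultimately have "((\<lambda>t. f (x + t *\<^sub>R (z - x))) has_derivative (\<lambda>t. 0)) (at 0)"
      by (rule has_derivative_compose)
    then show ?thesis
      unfolding g_def[abs_def] has_field_derivative_def mult_zero_left .
  qed
  ultimately have "g 1 - g 0 \<ge> 0 * (1 - 0)"
    by (intro convex_on_imp_above_tangent[where A = UNIV]) auto
  then show ?thesis
    by (simp add: g_def)
qed

text \<open>One radius serves all \<open>u\<close> with norm at most \<open>C\<close>; this
  uniformity later makes the maximizers locally bounded.\<close>

lemma super_coercive_bound:
  fixes f :: "'a::real_inner \<Rightarrow> real"
  assumes "super_coercive f"
  obtains R where "\<And>u x. \<lbrakk>norm u \<le> C; norm x > R\<rbrakk> \<Longrightarrow> inner u x - f x < c"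
proof -
  \<comment> \<open>The slope \<open>C + 1\<close> exceeds the Cauchy-Schwarz bound on
    \<open>inner u x\<close> by \<open>norm x\<close>, which in turn exceeds
    \<open>\<bar>c\<bar>\<close>.\<close>
  have "eventually (\<lambda>x. f x / norm x \<ge> C + 1) at_infinity"
    using assms unfolding super_coercive_def filterlim_at_top by blast
  then obtain B where B: "\<And>x. norm x \<ge> B \<Longrightarrow> f x / norm x \<ge> C + 1"
    unfolding eventually_at_infinity by blast
  show ?thesis
  proof
    fix u x :: 'a
    assume u: "norm u \<le> C" and x: "norm x > max B \<bar>c\<bar>"
    have "norm x > 0"
      using x by linarith
    then have "(C + 1) * norm x \<le> f x"
      using B[of x] x by (simp add: field_simps)
    moreover have "inner u x \<le> C * norm x"
      using norm_cauchy_schwarz[of u x] mult_right_mono[OF u norm_ge_zero[of x]] by linarith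
    ultimately have "inner u x - f x \<le> - norm x"
      by (simp add: algebra_simps)
    then show "inner u x - f x < c"
      using x by linarith
  qed
qed

section \<open>The conjugate of a prox-function and its gradient\<close>

locale prox_function =
  fixes \<phi> :: "'a::euclidean_space \<Rightarrow> real"
  assumes strictly_convex: "strictly_convex_on UNIV \<phi>"
    and differentiable: "\<phi> differentiable (at z)"
    and coercive: "super_coercive \<phi>"
begin

text \<open>Equivalently, \<open>u\<close> is a subgradient of \<open>\<phi>\<close> at
  \<open>x\<close>.\<close>

definition conjugate_maximizer :: "'a \<Rightarrow> 'a \<Rightarrow> bool"
  where "conjugate_maximizer u x \<longleftrightarrow> (\<forall>z. inner u z - \<phi> z \<le> inner u x - \<phi> x)"

text \<open>Stands in for the gradient of the conjugate until differentiability is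
  established.\<close>

definition conjugate_point :: "'a \<Rightarrow> 'a"
  where "conjugate_point u = (SOME x. conjugate_maximizer u x)"

lemma continuous_on: "continuous_on S \<phi>"
  by (meson continuous_at_imp_continuous_on differentiable differentiable_imp_continuous_within)

lemma conjugate_maximizer_bound:
  obtains R where "\<And>u x. \<lbrakk>norm u \<le> C; conjugate_maximizer u x\<rbrakk> \<Longrightarrow> norm x \<le> R"
proof -
  obtain R where R: "\<And>u x. \<lbrakk>norm u \<le> C; norm x > R\<rbrakk> \<Longrightarrow> inner u x - \<phi> x < - \<phi> 0"
    using super_coercive_bound[OF coercive] by blast
  show ?thesis
  proof
    fix u x assume "norm u \<le> C" "conjugate_maximizer u x"
    moreover from this have "inner u 0 - \<phi> 0 \<le> inner u x - \<phi> x"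
      unfolding conjugate_maximizer_def by blast
    ultimately show "norm x \<le> R"
      using R[of u x] by fastforce
  qed
qed

lemma conjugate_maximizer_exists: "\<exists>x. conjugate_maximizer u x"
proof -
  obtain R where R: "\<And>w x. \<lbrakk>norm w \<le> norm u; norm x > R\<rbrakk> \<Longrightarrow> inner w x - \<phi> x < - \<phi> 0"
    using super_coercive_bound[OF coercive] by blast
  \<comment> \<open>The absolute value keeps 0 in the ball, so the maximum over it is at least
    \<open>- \<phi> 0\<close> and beats every point outside.\<close>
  have "continuous_on (cball 0 \<bar>R\<bar>) (\<lambda>x. inner u x - \<phi> x)"
    by (intro continuous_intros continuous_on)
  then obtain x where x: "\<And>z. z \<in> cball 0 \<bar>R\<bar> \<Longrightarrow> inner u z - \<phi> z \<le> inner u x - \<phi> x"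
    using continuous_attains_sup[of "cball 0 \<bar>R\<bar>" "\<lambda>x. inner u x - \<phi> x"] by fastforce
  have "inner u z - \<phi> z \<le> inner u x - \<phi> x" for z
  proof (cases "norm z \<le> \<bar>R\<bar>")
    case True
    then show ?thesis
      using x by simp
  next
    case False
    then have "inner u z - \<phi> z < - \<phi> 0"
      using R[of u z] by simp
    then show ?thesis
      using x[of 0] by simp
  qed
  then show ?thesis
    unfolding conjugate_maximizer_def by blast
qed

text \<open>The midpoint of two distinct maximizers would do strictly better.\<close>

lemma conjugate_maximizer_unique:
  assumes x: "conjugate_maximizer u x" and z: "conjugate_maximizer u z"
  shows "x = z"
proof (rule ccontr)
  assume "x \<noteq> z"
  then have "\<phi> ((1/2) *\<^sub>R x + (1/2) *\<^sub>R z) < 1/2 * \<phi> x + 1/2 * \<phi> z"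
    using strictly_convex unfolding strictly_convex_on_def
    by (metis UNIV_I field_sum_of_halves zero_less_divide_1_iff zero_less_numeral)
  moreover have "inner u ((1/2) *\<^sub>R x + (1/2) *\<^sub>R z) = 1/2 * inner u x + 1/2 * inner u z"
    by (simp add: inner_add_right)
  moreover have "inner u ((1/2) *\<^sub>R x + (1/2) *\<^sub>R z) - \<phi> ((1/2) *\<^sub>R x + (1/2) *\<^sub>R z)
      \<le> inner u x - \<phi> x" "inner u x - \<phi> x = inner u z - \<phi> z"
    using x z unfolding conjugate_maximizer_def by (auto intro: antisym)
  ultimately show False
    by argo
qed

lemma conjugate_maximizer_conjugate_point: "conjugate_maximizer u (conjugate_point u)"
  unfolding conjugate_point_def using conjugate_maximizer_exists by (rule someI_ex)

lemma conjugate_point_eqI: "conjugate_maximizer u x \<Longrightarrow> conjugate_point u = x"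
  using conjugate_maximizer_unique conjugate_maximizer_conjugate_point by blast

text \<open>The supremum is attained, so the real-valued \<open>SUP\<close> is a genuine
  maximum.\<close>

lemma convex_conjugate_eq:
  "convex_conjugate \<phi> u = inner u (conjugate_point u) - \<phi> (conjugate_point u)"
  unfolding convex_conjugate_def
  using conjugate_maximizer_conjugate_point[of u]
  by (intro cSup_eq_maximum) (auto simp: conjugate_maximizer_def)

lemma Fenchel_Young: "inner u z - \<phi> z \<le> convex_conjugate \<phi> u"
  using conjugate_maximizer_conjugate_point[of u]
  unfolding convex_conjugate_eq conjugate_maximizer_def by blast

text \<open>This is the first-order condition at a maximizer.\<close>

lemma gradient_conjugate_point: "gradient \<phi> (conjugate_point u) = u"
proof -
  let ?p = "conjugate_point u"
  have "((\<lambda>z. inner u z - \<phi> z) has_derivative (\<lambda>h. inner u h - inner h (gradient \<phi> ?p))) (at ?p)"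
    using GDERIV_gradient[OF differentiable, of ?p] unfolding gderiv_def
    by (auto intro!: derivative_eq_intros)
  then have "(\<lambda>h. inner u h - inner h (gradient \<phi> ?p)) = (\<lambda>h. 0)"
    using conjugate_maximizer_conjugate_point[of u]
    by (intro differential_zero_maxmin[where S = UNIV]) (auto simp: conjugate_maximizer_def)
  then have "inner h u = inner h (gradient \<phi> ?p)" for h
    by (metis eq_iff_diff_eq_0 inner_commute)
  then show ?thesis
    by (metis vector_eq_ldot)
qed

text \<open>Near \<open>u\<close> the maximizers stay in a compact ball, and a map into a compact
  set with closed graph is continuous.\<close>

lemma isCont_conjugate_point: "isCont conjugate_point u"
proof -
  let ?S = "cball u 1"
  obtain R where R: "\<And>w x. \<lbrakk>norm w \<le> norm u + 1; conjugate_maximizer w x\<rbrakk> \<Longrightarrow> norm x \<le> R"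
    using conjugate_maximizer_bound by blast
  have "norm w \<le> norm u + 1" if "w \<in> ?S" for w
    using that norm_triangle_sub[of w u] by (simp add: dist_norm norm_minus_commute)
  then have "norm (conjugate_point w) \<le> R" if "w \<in> ?S" for w
    using R conjugate_maximizer_conjugate_point that by blast
  then have im: "conjugate_point \<in> ?S \<rightarrow> cball 0 R"
    by auto
  \<comment> \<open>By uniqueness of maximizers, the graph is cut out by one closed inequality for
    each competitor \<open>z\<close>.\<close>
  have "(\<lambda>w. (w, conjugate_point w)) ` ?S = (?S \<times> UNIV) \<inter>
      (\<Inter>z. {p. inner (fst p) z - \<phi> z \<le> inner (fst p) (snd p) - \<phi> (snd p)})"
    using conjugate_maximizer_conjugate_point conjugate_point_eqI
    by (fastforce simp: conjugate_maximizer_def image_iff)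
  moreover have "continuous_on UNIV (\<lambda>p::'a \<times> 'a. \<phi> (snd p))"
    by (rule continuous_on_compose2[OF continuous_on[of UNIV]]) (auto intro: continuous_intros)
  ultimately have "closed ((\<lambda>w. (w, conjugate_point w)) ` ?S)"
    by (auto intro!: closed_Int closed_INT closed_Times closed_Collect_le continuous_intros)
  then have "continuous_on ?S conjugate_point"
    using im by (intro continuous_from_closed_graph[of "cball 0 R"]) auto
  then show ?thesis
    by (intro continuous_on_interior[of ?S]) auto
qed

text \<open>The remainder quotient is at most the displacement of the maximizer, so continuity of
  the maximizer suffices.\<close>

lemma GDERIV_convex_conjugate: "GDERIV (convex_conjugate \<phi>) u :> conjugate_point u"
proof -
  let ?F = "convex_conjugate \<phi>" and ?p = conjugate_point
  have bound: "norm (?F w - ?F u - inner (w - u) (?p u)) / norm (w - u) \<le> norm (?p w - ?p u)"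
    (is "_ / _ \<le> ?N") for w
  proof -
    \<comment> \<open>Fenchel--Young at both maximizers sandwiches the remainder.\<close>
    have "0 \<le> ?F w - ?F u - inner (w - u) (?p u)"
      using Fenchel_Young[of w "?p u"] convex_conjugate_eq[of u] by (simp add: inner_diff_left)
    moreover have "?F w - ?F u - inner (w - u) (?p u) \<le> inner (w - u) (?p w - ?p u)"
      using Fenchel_Young[of u "?p w"] convex_conjugate_eq[of w] by (simp add: inner_diff)
    moreover have "inner (w - u) (?p w - ?p u) \<le> norm (w - u) * ?N"
      by (rule norm_cauchy_schwarz)
    \<comment> \<open>At \<open>w = u\<close> the quotient is \<open>0 / 0\<close>, which is
      0.\<close>
    ultimately show ?thesis
      by (cases "w = u") (auto simp: divide_le_eq mult.commute)
  qed
  have "((\<lambda>w. norm (?p w - ?p u)) \<longlongrightarrow> 0) (at u)"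
    using isCont_conjugate_point[of u] by (simp add: isCont_def LIM_zero tendsto_norm_zero)
  then have "((\<lambda>w. norm (?F w - ?F u - inner (w - u) (?p u)) / norm (w - u)) \<longlongrightarrow> 0) (at u)"
    by (rule Lim_null_comparison[rotated]) (use bound in \<open>simp add: always_eventually\<close>)
  then show ?thesis
    unfolding gderiv_def has_derivative_iff_norm by (auto intro: bounded_linear_inner_left)
qed

lemma gradient_convex_conjugate: "gradient (convex_conjugate \<phi>) u = conjugate_point u"
  by (rule gradient_eqI) (rule GDERIV_convex_conjugate)

lemma conjugate_point_zero:
  assumes "gradient \<phi> 0 = 0"
  shows "conjugate_point 0 = 0"
proof (rule conjugate_point_eqI)
  have "\<phi> 0 \<le> \<phi> z" for z
    using assms GDERIV_gradient[OF differentiable, of 0]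
    by (intro convex_on_stationary_imp_minimizer strictly_convex_on_imp_convex_on
        strictly_convex) simp
  then show "conjugate_maximizer 0 0"
    by (simp add: conjugate_maximizer_def)
qed

text \<open>Duality swaps the arguments: writing both conjugate values at their maximizers cancels
  the terms in \<open>w\<close>.\<close>

lemma bregman_convex_conjugate:
  "bregman (convex_conjugate \<phi>) u w = bregman \<phi> (conjugate_point w) (conjugate_point u)"
  unfolding bregman_def gradient_convex_conjugate gradient_conjugate_point convex_conjugate_eq
  by (simp add: inner_diff inner_commute)

text \<open>The distance is the gap in the Fenchel-Young inequality for \<open>u\<close> and
  \<open>conjugate_point w\<close>.\<close>

lemma bregman_convex_conjugate_nonneg: "0 \<le> bregman (convex_conjugate \<phi>) u w"
  using Fenchel_Young[of u "conjugate_point w"] convex_conjugate_eq[of w]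
  unfolding bregman_def gradient_convex_conjugate by (simp add: inner_diff inner_commute)

text \<open>Testing the supremum at the unit vector \<open>sgn u\<close> gives linear growth;
  \<open>M\<close> bounds \<open>\<phi>\<close> on the unit ball. Upper bounds on the conjugate thus
  bound its argument.\<close>

lemma convex_conjugate_lower_bound:
  obtains M where "\<And>u. norm u \<le> convex_conjugate \<phi> u + M"
proof -
  have "compact (\<phi> ` cball 0 1)"
    by (intro compact_continuous_image continuous_on compact_cball)
  then obtain M where M: "\<And>x. norm x \<le> 1 \<Longrightarrow> \<bar>\<phi> x\<bar> \<le> M"
    using compact_imp_bounded bounded_iff[of "\<phi> ` cball 0 1"] by fastforce
  show ?thesis
  proof
    fix u :: 'a
    have "inner u (sgn u) = norm u"
      by (simp add: sgn_div_norm dot_square_norm power2_eq_square field_simps)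
    moreover have "\<bar>\<phi> (sgn u)\<bar> \<le> M"
      by (rule M) (simp add: norm_sgn)
    ultimately show "norm u \<le> convex_conjugate \<phi> u + M"
      using Fenchel_Young[of u "sgn u"] by linarith
  qed
qed

end

section \<open>Descent and boundedness along the iteration\<close>

theorem lemma4p14:
  fixes \<phi> :: "'a::euclidean_space \<Rightarrow> real"
    and T :: "'a \<Rightarrow> 'a set"
    and x v y :: "nat \<Rightarrow> 'a"
  assumes "strictly_convex_on UNIV \<phi>"
    and "\<forall>z. \<phi> differentiable (at z)"
    and "super_coercive \<phi>"
    and "gradient \<phi> 0 = 0"
    and "maximal_monotone_mapping T"
    and "\<forall>k. v k \<in> T (x (k + 1))"
    and "\<forall>k. x (k + 1) = x k - gradient (convex_conjugate \<phi>) (v k)"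
    and "\<forall>k. y k = x k - x (k + 1)"
  shows "(\<forall>k. v k = gradient \<phi> (y k)) \<and>
    \<comment> \<open>(i)\<close>
    (\<forall>k. bregman (convex_conjugate \<phi>) (v (k + 1)) 0
        \<le> bregman (convex_conjugate \<phi>) (v k) 0
          - bregman (convex_conjugate \<phi>) (v k) (v (k + 1))) \<and>
    \<comment> \<open>(ii)\<close>
    convergent (\<lambda>k. bregman (convex_conjugate \<phi>) (v k) 0) \<and>
    \<comment> \<open>(iii)\<close>
    summable (\<lambda>k. bregman (convex_conjugate \<phi>) (v k) (v (k + 1))) \<and>
    (\<lambda>k. bregman (convex_conjugate \<phi>) (v k) (v (k + 1))) \<longlonglongrightarrow> 0 \<and>
    \<comment> \<open>(iv)\<close>
    (\<forall>k. bregman (convex_conjugate \<phi>) (v k) 0 = bregman \<phi> 0 (y k) \<and>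
         bregman (convex_conjugate \<phi>) (v k) (v (k + 1)) = bregman \<phi> (y (k + 1)) (y k)) \<and>
    \<comment> \<open>(v)\<close>
    summable (\<lambda>k. inner (x (k + 2) - x (k + 1)) (v (k + 1) - v k)) \<and>
    0 \<le> (\<Sum>k. inner (x (k + 2) - x (k + 1)) (v (k + 1) - v k)) \<and>
    (\<lambda>k. inner (x (k + 2) - x (k + 1)) (v (k + 1) - v k)) \<longlonglongrightarrow> 0 \<and>
    \<comment> \<open>(vi)\<close>
    bounded (range v) \<and> bounded (range y)"
proof -
  interpret prox_function \<phi>
    using assms by unfold_locales blast+
  let ?F = "convex_conjugate \<phi>"
  let ?d = "\<lambda>k. inner (x (k + 2) - x (k + 1)) (v (k + 1) - v k)"
  define D where "D k = bregman ?F (v k) 0" for k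
  define E where "E k = bregman ?F (v k) (v (k + 1))" for k
  have y: "y k = conjugate_point (v k)" for k
    using assms(7,8) by (simp add: gradient_convex_conjugate)
  have x_diff: "x (k + 2) - x (k + 1) = - conjugate_point (v (k + 1))" for k
    using assms(7)[rule_format, of "k + 1"] by (simp add: gradient_convex_conjugate)
  have D_eq: "D k = ?F (v k) - ?F 0" for k
    using conjugate_point_zero[OF assms(4)]
    by (simp add: D_def bregman_def gradient_convex_conjugate)
  have three_point: "?d k = D k - D (k + 1) - E k" for k
    unfolding x_diff D_eq E_def bregman_def gradient_convex_conjugate
    by (simp add: inner_diff_right)
  \<comment> \<open>The inclusion pairs \<open>v k\<close> with the later iterate
    \<open>x (k + 1)\<close>, hence the shifted indices in \<open>?d\<close>.\<close>
  have d_nonneg: "0 \<le> ?d k" for k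
  proof -
    have "monotone_mapping T"
      using assms(5) unfolding maximal_monotone_mapping_def by blast
    moreover have "(x (k + 2), v (k + 1)) \<in> mapping_graph T" "(x (k + 1), v k) \<in> mapping_graph T"
      using assms(6)[rule_format, of k] assms(6)[rule_format, of "k + 1"]
      by (simp_all add: mapping_graph_def)
    ultimately show ?thesis
      unfolding monotone_mapping_def by fast
  qed
  have nonneg: "0 \<le> D k" "0 \<le> E k" for k
    unfolding D_def E_def by (rule bregman_convex_conjugate_nonneg)+
  have step: "D (k + 1) \<le> D k - E k" for k
    using three_point[of k] d_nonneg[of k] by linarith
  have "decseq D"
    using step nonneg by (intro decseq_SucI) (smt (verit) Suc_eq_plus1)
  then obtain l where l: "D \<longlonglongrightarrow> l"
    using decseq_convergent[of D 0] nonneg(1) by blast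
  then have telescope: "summable (\<lambda>k. D k - D (k + 1))"
    using telescope_sums'[of D l] by (simp add: sums_iff)
  \<comment> \<open>By \<open>step\<close>, \<open>E\<close> is dominated by the telescoping
    differences of \<open>D\<close>.\<close>
  have E_summable: "summable E"
    using nonneg step by (intro summable_comparison_test'[OF telescope]) (smt (verit) real_norm_def)
  have d_summable: "summable ?d"
    using summable_diff[OF telescope E_summable] unfolding three_point .
  have v_bounded: "bounded (range v)"
  proof -
    obtain M where M: "\<And>u. norm u \<le> ?F u + M"
      using convex_conjugate_lower_bound by blast
    \<comment> \<open>Monotonicity of \<open>D\<close> bounds the conjugate at \<open>v k\<close> by
      \<open>D 0 + ?F 0\<close>.\<close>
    have "norm (v k) \<le> D 0 + ?F 0 + M" for k
      using M[of "v k"] D_eq[of k] decseqD[OF \<open>decseq D\<close>, of 0 k] by simp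
    then show ?thesis
      by (auto simp: bounded_iff)
  qed
  then obtain C where "\<And>k. norm (v k) \<le> C"
    by (auto simp: bounded_iff)
  \<comment> \<open>Each \<open>y k\<close> is the maximizer for \<open>v k\<close>, so the uniform
    bound on maximizers carries boundedness from \<open>v\<close> to \<open>y\<close>.\<close>
  moreover obtain R where "\<And>u z. \<lbrakk>norm u \<le> C; conjugate_maximizer u z\<rbrakk> \<Longrightarrow> norm z \<le> R"
    using conjugate_maximizer_bound by blast
  ultimately have "norm (y k) \<le> R" for k
    unfolding y using conjugate_maximizer_conjugate_point by blast
  then have y_bounded: "bounded (range y)"
    by (auto simp: bounded_iff)
  show ?thesis
  proof (intro conjI allI)
    show "v k = gradient \<phi> (y k)" for k
      by (simp add: y gradient_conjugate_point)
    show "bregman ?F (v (k + 1)) 0 \<le> bregman ?F (v k) 0 - bregman ?F (v k) (v (k + 1))" for k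
      using step unfolding D_def E_def .
    show "convergent (\<lambda>k. bregman ?F (v k) 0)"
      using convergentI[OF l] unfolding D_def[abs_def] .
    show "summable (\<lambda>k. bregman ?F (v k) (v (k + 1)))"
      using E_summable unfolding E_def[abs_def] .
    then show "(\<lambda>k. bregman ?F (v k) (v (k + 1))) \<longlonglongrightarrow> 0"
      by (rule summable_LIMSEQ_zero)
    show "bregman ?F (v k) 0 = bregman \<phi> 0 (y k)" for k
      by (simp add: bregman_convex_conjugate y conjugate_point_zero[OF assms(4)])
    show "bregman ?F (v k) (v (k + 1)) = bregman \<phi> (y (k + 1)) (y k)" for k
      by (simp add: bregman_convex_conjugate y)
    show "summable ?d" "?d \<longlonglongrightarrow> 0"
      using d_summable summable_LIMSEQ_zero by blast+
    show "0 \<le> (\<Sum>k. ?d k)"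
      using d_summable d_nonneg by (rule suminf_nonneg)
    show "bounded (range v)" "bounded (range y)"
      by fact+
  qed
qed

end
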